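(* Any online algorithm with advice for multi-coloring hexagonal graphs whose strict competitive ratio is strictly smaller than $\frac{3}{2}$ has advice complexity at least $\lfloor\frac{n-1}{3}\rfloor$, where $n$ is the number of requests.
   Context: A hexagonal graph is a graph obtained by placing at most one node in each cell of a hexagonal grid and adding an edge between every pair of nodes in neighboring cells. Online multi-coloring: the graph is known in advance; requests arrive one at a time, each naming a node $v$, and must immediately and irrevocably receive a color (positive integer) different from every color previously assigned to $v$ or any neighbor of $v$. $A(I)$ is the number of colors used and $\mathrm{Opt}(I)$ the minimum number an offline algorithm needs. Advice model: an all-powerful oracle knowing $I$ writes an infinite binary advice tape; advice complexity is the maximum index of a bit read. The strict competitive ratio of $A$ is the infimum of all $c$ such that $A(I)\le c\cdot\mathrm{Opt}(I)$ for all $I$. *)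

theory Defs
  imports
    Graph_Theory.Pair_Digraph
    "HOL-Library.Infinite_Typeclass"
    "HOL-Library.Extended_Real"
begin

text \<open>Cells of the hexagonal grid are given by axial coordinates: the six neighbors of
  \<open>(0, 0)\<close> are \<open>(1, 0)\<close>, \<open>(0, 1)\<close>, \<open>(- 1, 1)\<close> and their negatives.\<close>

definition neighboring_cells :: "int \<times> int \<Rightarrow> int \<times> int \<Rightarrow> bool" where
  "neighboring_cells c d \<longleftrightarrow>
     (fst d - fst c, snd d - snd c) \<in> {(1, 0), (- 1, 0), (0, 1), (0, - 1), (1, - 1), (- 1, 1)}"

definition hexagonal_graph :: "'v pair_pre_digraph \<Rightarrow> bool" where
  "hexagonal_graph G \<longleftrightarrow> finite (pverts G) \<and>
     (\<exists>cell :: 'v \<Rightarrow> int \<times> int. inj_on cell (pverts G) \<and>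
        parcs G = {(u, v). u \<in> pverts G \<and> v \<in> pverts G \<and> neighboring_cells (cell u) (cell v)})"

definition hex_inputs :: "('v pair_pre_digraph \<times> 'v list) set" where
  "hex_inputs = {(G, rs). hexagonal_graph G \<and> set rs \<subseteq> pverts G}"

definition multicoloring :: "'v pair_pre_digraph \<Rightarrow> 'v list \<Rightarrow> nat list \<Rightarrow> bool" where
  "multicoloring G rs cs \<longleftrightarrow>
     length cs = length rs \<and> (\<forall>c \<in> set cs. 1 \<le> c) \<and>
     (\<forall>j < length rs. \<forall>i < j.
        rs ! i = rs ! j \<or> (rs ! i, rs ! j) \<in> parcs G \<longrightarrow> cs ! i \<noteq> cs ! j)"

definition opt :: "'v pair_pre_digraph \<Rightarrow> 'v list \<Rightarrow> nat" where
  "opt G rs = (LEAST k. \<exists>cs. multicoloring G rs cs \<and> card (set cs) = k)"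

text \<open>The next action of an online algorithm depends on the graph, on the requests received so far
  (the current one being the last), and on the positions and values of the advice bits read so far;
  its own earlier answers are determined by these. The algorithm may read any number of bits,
  at positions chosen adaptively, before it answers a request.
  An advisor writes the whole tape, knowing the graph and the entire request sequence.\<close>

datatype action = Read_Bit nat | Answer nat

type_synonym history = "(nat \<times> bool) list"
type_synonym tape = "nat \<Rightarrow> bool"
type_synonym 'v online_algorithm = "'v pair_pre_digraph \<Rightarrow> 'v list \<Rightarrow> history \<Rightarrow> action"
type_synonym 'v advisor = "'v pair_pre_digraph \<Rightarrow> 'v list \<Rightarrow> tape"

inductive serve ::
    "'v online_algorithm \<Rightarrow> 'v pair_pre_digraph \<Rightarrow> tape \<Rightarrow> 'v list \<Rightarrow> history \<Rightarrow> nat \<Rightarrow> history \<Rightarrow> bool"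
  for A G \<phi> rs where
  answer: "A G rs h = Answer c \<Longrightarrow> serve A G \<phi> rs h c h"
| read_bit: "A G rs h = Read_Bit p \<Longrightarrow> serve A G \<phi> rs (h @ [(p, \<phi> p)]) c h' \<Longrightarrow> serve A G \<phi> rs h c h'"

inductive run ::
    "'v online_algorithm \<Rightarrow> 'v pair_pre_digraph \<Rightarrow> tape \<Rightarrow> 'v list \<Rightarrow> nat list \<Rightarrow> history \<Rightarrow> bool"
  for A G \<phi> where
  run_Nil: "run A G \<phi> [] [] []"
| run_snoc: "run A G \<phi> rs cs h \<Longrightarrow> serve A G \<phi> (rs @ [v]) h c h' \<Longrightarrow>
    run A G \<phi> (rs @ [v]) (cs @ [c]) h'"

lemma serve_deterministic:
  assumes "serve A G \<phi> rs h c h1" "serve A G \<phi> rs h d h2"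
  shows "c = d \<and> h1 = h2"
  using assms
proof (induction arbitrary: d h2 rule: serve.induct)
  case (answer h c)
  from answer.prems answer.hyps show ?case by cases auto
next
  case (read_bit h p c h')
  from read_bit.prems read_bit.hyps have "serve A G \<phi> rs (h @ [(p, \<phi> p)]) d h2"
    by cases auto
  then show ?case by (rule read_bit.IH)
qed

lemma run_deterministic:
  assumes "run A G \<phi> rs cs h" "run A G \<phi> rs ds k"
  shows "cs = ds \<and> h = k"
  using assms
proof (induction arbitrary: ds k rule: run.induct)
  case run_Nil
  then show ?case by cases auto
next
  case (run_snoc rs cs h v c h')
  from run_snoc.prems obtain ds' k' d where
    "ds = ds' @ [d]" "run A G \<phi> rs ds' k'" "serve A G \<phi> (rs @ [v]) k' d k"
    by cases auto
  with run_snoc.IH run_snoc.hyps serve_deterministic show ?case by metis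
qed

definition online_colors :: "'v online_algorithm \<Rightarrow> 'v advisor \<Rightarrow> 'v pair_pre_digraph \<Rightarrow> 'v list \<Rightarrow> nat list" where
  "online_colors A \<Phi> G rs = (THE cs. \<exists>h. run A G (\<Phi> G rs) rs cs h)"

definition bits_read :: "'v online_algorithm \<Rightarrow> 'v advisor \<Rightarrow> 'v pair_pre_digraph \<Rightarrow> 'v list \<Rightarrow> history" where
  "bits_read A \<Phi> G rs = (THE h. \<exists>cs. run A G (\<Phi> G rs) rs cs h)"

definition hex_multicoloring_algorithm :: "'v online_algorithm \<Rightarrow> 'v advisor \<Rightarrow> bool" where
  "hex_multicoloring_algorithm A \<Phi> \<longleftrightarrow>
     (\<forall>(G, rs) \<in> hex_inputs. \<exists>cs h. run A G (\<Phi> G rs) rs cs h \<and> multicoloring G rs cs)"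

definition strict_competitive_ratio :: "'v online_algorithm \<Rightarrow> 'v advisor \<Rightarrow> ereal" where
  "strict_competitive_ratio A \<Phi> =
     Inf {ereal c | c. \<forall>(G, rs) \<in> hex_inputs.
       real (card (set (online_colors A \<Phi> G rs))) \<le> c * real (opt G rs)}"

text \<open>Positions on the tape are counted from 0, so the bit at position \<open>p\<close> has index \<open>Suc p\<close>.
  The value is 0 if no bit is read.\<close>

definition max_index_read :: "history \<Rightarrow> nat" where
  "max_index_read h = Max (insert 0 ((\<lambda>(p, b). Suc p) ` set h))"

definition advice_complexity :: "'v online_algorithm \<Rightarrow> 'v advisor \<Rightarrow> nat \<Rightarrow> enat" where
  "advice_complexity A \<Phi> n =
     (SUP (G, rs) \<in> {(G, rs) \<in> hex_inputs. length rs = n}. enat (max_index_read (bits_read A \<Phi> G rs)))"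

end

theory Submission imports Defs begin

text \<open>Request \<open>m + 1\<close> hubs, placed two apart in a row, where \<open>m\<close> is the claimed bound. For a set
  \<open>S \<subseteq> {..<m}\<close>, then join hubs \<open>i\<close> and \<open>i + 1\<close> through one cell (a link) if \<open>i \<in> S\<close>, and through two
  cells (a detour) otherwise; isolated spare cells make up for the missing requests. The requested
  cells form a bipartite graph, so \<open>Opt \<le> 2\<close>, and a ratio below \<open>3 / 2\<close> forces the algorithm to use
  at most two colors. Hence hubs \<open>i\<close> and \<open>i + 1\<close> have the same color iff \<open>i \<in> S\<close>: the colors of the
  hubs, all given before anything about \<open>S\<close> is revealed, determine \<open>S\<close>. With fewer than \<open>m\<close> bits
  there are fewer than \<open>2\<^sup>m\<close> ways to color them.\<close>

section \<open>Runs of an online algorithm and the tape\<close>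

lemma serve_history_mono:
  assumes "serve A G \<phi> rs h c h'"
  shows "set h \<subseteq> set h'"
  using assms by induction auto

text \<open>The tape enters only through bits appended to the history, and histories only grow, so
  every bit consulted is recorded in \<open>h'\<close>. Tapes agreeing at these positions cannot be
  told apart.\<close>

lemma serve_cong_tape:
  assumes "serve A G \<phi> rs h c h'" "\<And>p b. (p, b) \<in> set h' \<Longrightarrow> \<phi> p = \<psi> p"
  shows "serve A G \<psi> rs h c h'"
  using assms
proof induction
  case (answer h c)
  then show ?case by (auto intro: serve.answer)
next
  case (read_bit h p c h')
  have "(p, \<phi> p) \<in> set h'"
    using serve_history_mono[OF read_bit.hyps(2)] by auto
  then have "\<phi> p = \<psi> p" by (rule read_bit.prems)
  moreover have "serve A G \<psi> rs (h @ [(p, \<phi> p)]) c h'"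
    using read_bit.prems by (rule read_bit.IH)
  ultimately show ?case
    using read_bit.hyps(1) serve.read_bit[of A G rs h p \<psi>] by simp
qed

lemma run_cong_tape:
  assumes "run A G \<phi> rs cs h" "\<And>p b. (p, b) \<in> set h \<Longrightarrow> \<phi> p = \<psi> p"
  shows "run A G \<psi> rs cs h"
  using assms
proof induction
  case run_Nil
  show ?case by (rule run.run_Nil)
next
  case (run_snoc rs cs h v c h')
  have "set h \<subseteq> set h'"
    using run_snoc.hyps(2) by (rule serve_history_mono)
  then have "run A G \<psi> rs cs h"
    using run_snoc.prems by (intro run_snoc.IH) blast
  moreover have "serve A G \<psi> (rs @ [v]) h c h'"
    using run_snoc.hyps(2) run_snoc.prems by (rule serve_cong_tape)
  ultimately show ?case by (rule run.run_snoc)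
qed

lemma run_length:
  assumes "run A G \<phi> rs cs h"
  shows "length cs = length rs"
  using assms by induction auto

text \<open>Answers are irrevocable: the requests in \<open>ys\<close> only append answers and bits.
  The inclusion \<open>set k \<subseteq> set h\<close> carries a bound on the positions read over to
  the prefix.\<close>

lemma run_prefix:
  assumes "run A G \<phi> (rs @ ys) cs h"
  obtains ds es k where "cs = ds @ es" "run A G \<phi> rs ds k" "set k \<subseteq> set h"
proof -
  have "\<exists>ds es k. cs = ds @ es \<and> run A G \<phi> rs ds k \<and> set k \<subseteq> set h"
    using assms
  proof (induction ys arbitrary: cs h rule: rev_induct)
    case Nil
    then show ?case
      by (intro exI[of _ cs] exI[of _ "[]"] exI[of _ h]) simp
  next
    case (snoc y ys)
    from snoc.prems obtain cs' h' c where
      cs: "cs = cs' @ [c]" and "run A G \<phi> (rs @ ys) cs' h'"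
      and s: "serve A G \<phi> ((rs @ ys) @ [y]) h' c h"
      by cases auto
    from snoc.IH[OF this(2)] obtain ds es k where
      "cs' = ds @ es" "run A G \<phi> rs ds k" "set k \<subseteq> set h'" by blast
    with cs serve_history_mono[OF s] show ?case
      by (intro exI[of _ ds] exI[of _ "es @ [c]"] exI[of _ k]) auto
  qed
  with that show ?thesis by blast
qed

lemma online_colors_eq:
  assumes "run A G (\<Phi> G rs) rs cs h"
  shows "online_colors A \<Phi> G rs = cs"
  unfolding online_colors_def
proof (rule the_equality)
  show "\<exists>h. run A G (\<Phi> G rs) rs cs h" using assms ..
  show "ds = cs" if "\<exists>h. run A G (\<Phi> G rs) rs ds h" for ds
    using that run_deterministic[of A G "\<Phi> G rs", OF assms] by fast
qed

lemma bits_read_eq: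
  assumes "run A G (\<Phi> G rs) rs cs h"
  shows "bits_read A \<Phi> G rs = h"
  unfolding bits_read_def
proof (rule the_equality)
  show "\<exists>cs. run A G (\<Phi> G rs) rs cs h" using assms ..
  show "k = h" if "\<exists>cs. run A G (\<Phi> G rs) rs cs k" for k
    using that run_deterministic[of A G "\<Phi> G rs", OF assms] by fast
qed

lemma max_index_read_ge:
  assumes "(p, b) \<in> set h"
  shows "Suc p \<le> max_index_read h"
proof -
  have "(\<lambda>(p, b). Suc p) (p, b) \<in> (\<lambda>(p, b). Suc p) ` set h"
    using assms by (rule imageI)
  then have "Suc p \<in> (\<lambda>(p, b). Suc p) ` set h"
    by (simp only: prod.case)
  then show ?thesis
    unfolding max_index_read_def by (intro Max_ge finite.insertI finite_imageI finite_set insertI2)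
qed

section \<open>Graphs and colorings given by sets of cells\<close>

lemma neighboring_cells_Pair:
  "neighboring_cells (a, b) (c, d) \<longleftrightarrow>
     d = b \<and> (c = a + 1 \<or> a = c + 1) \<or> d = b + 1 \<and> (c = a \<or> a = c + 1) \<or>
     b = d + 1 \<and> (c = a \<or> c = a + 1)"
  unfolding neighboring_cells_def fst_conv snd_conv insert_iff empty_iff prod.inject diff_eq_eq
  by (rule iffI; elim disjE conjE FalseE; simp)

lemma neighboring_cells_commute: "neighboring_cells x y \<longleftrightarrow> neighboring_cells y x"
  by (cases x; cases y; simp only: neighboring_cells_Pair; rule iffI; elim disjE conjE; simp)

text \<open>The node type is arbitrary, so \<open>f\<close> names the cells by nodes; for injective
  \<open>f\<close>, \<open>inv f\<close> recovers the placement.\<close>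

definition cell_graph :: "(int \<times> int \<Rightarrow> 'v) \<Rightarrow> (int \<times> int) set \<Rightarrow> 'v pair_pre_digraph" where
  "cell_graph f C = \<lparr>pverts = f ` C,
     parcs = {(f x, f y) | x y. x \<in> C \<and> y \<in> C \<and> neighboring_cells x y}\<rparr>"

lemma hexagonal_cell_graph:
  assumes "inj f" "finite C"
  shows "hexagonal_graph (cell_graph f C)"
proof -
  have "inj_on (inv f) (f ` C)"
    using assms(1) by (auto simp: inj_on_def)
  moreover have "{(f x, f y) | x y. x \<in> C \<and> y \<in> C \<and> neighboring_cells x y} =
      {(u, v). u \<in> f ` C \<and> v \<in> f ` C \<and> neighboring_cells (inv f u) (inv f v)}"
    by (auto simp: inv_f_f[OF assms(1)] simp del: split_paired_Ex) blast
  ultimately show ?thesis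
    unfolding hexagonal_graph_def cell_graph_def
    using assms(2) by (intro conjI exI[of _ "inv f"]) auto
qed

lemma parcs_cell_graph_iff:
  assumes "inj f" "x \<in> C" "y \<in> C"
  shows "(f x, f y) \<in> parcs (cell_graph f C) \<longleftrightarrow> neighboring_cells x y"
  using assms by (auto simp: cell_graph_def simp del: split_paired_Ex dest: injD)

text \<open>No cell is requested twice, so only adjacency constrains the colors; adjacency is
  symmetric, so the order of the requests drops out.\<close>

lemma multicoloring_cell_graph_map:
  assumes "inj f" "distinct xs" "set xs \<subseteq> C"
  shows "multicoloring (cell_graph f C) (map f xs) (map k xs) \<longleftrightarrow>
    (\<forall>x\<in>set xs. 1 \<le> k x) \<and>
    (\<forall>x\<in>set xs. \<forall>y\<in>set xs. neighboring_cells x y \<longrightarrow> k x \<noteq> k y)"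
proof -
  have "(\<forall>j<length xs. \<forall>i<j. f (xs ! i) = f (xs ! j) \<or>
           (f (xs ! i), f (xs ! j)) \<in> parcs (cell_graph f C) \<longrightarrow> k (xs ! i) \<noteq> k (xs ! j))
    \<longleftrightarrow> (\<forall>x\<in>set xs. \<forall>y\<in>set xs. neighboring_cells x y \<longrightarrow> k x \<noteq> k y)" (is "?L \<longleftrightarrow> ?R")
  proof
    assume L: ?L
    show ?R
    proof (intro ballI impI)
      fix x y assume "x \<in> set xs" "y \<in> set xs" and n: "neighboring_cells x y"
      then obtain i j where ij: "x = xs ! i" "y = xs ! j" "i < length xs" "j < length xs"
        by (auto simp: in_set_conv_nth)
      have "x \<noteq> y" using n by (cases x) (auto simp: neighboring_cells_Pair)
      then have "i < j \<or> j < i" using ij by (metis nat_neq_iff)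
      moreover have "(f x, f y) \<in> parcs (cell_graph f C)" "(f y, f x) \<in> parcs (cell_graph f C)"
        using n n[unfolded neighboring_cells_commute[of x y]] assms \<open>x \<in> set xs\<close> \<open>y \<in> set xs\<close>
        by (meson parcs_cell_graph_iff subsetD)+
      ultimately show "k x \<noteq> k y"
        using L ij by metis
    qed
  next
    assume R: ?R
    show ?L
    proof (intro allI impI)
      fix j i
      assume ij: "j < length xs" "i < j"
        and e: "f (xs ! i) = f (xs ! j) \<or> (f (xs ! i), f (xs ! j)) \<in> parcs (cell_graph f C)"
      then have i: "i < length xs" by simp
      have "xs ! i \<noteq> xs ! j"
        using assms(2) ij i by (simp add: nth_eq_iff_index_eq)
      then have "(f (xs ! i), f (xs ! j)) \<in> parcs (cell_graph f C)"
        using e assms(1) by (auto dest: injD)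
      then have "neighboring_cells (xs ! i) (xs ! j)"
        using assms ij i by (meson parcs_cell_graph_iff subsetD nth_mem)
      then show "k (xs ! i) \<noteq> k (xs ! j)"
        using R ij i by auto
    qed
  qed
  then show ?thesis
    by (auto simp: multicoloring_def)
qed

lemma opt_le:
  assumes "multicoloring G rs cs"
  shows "opt G rs \<le> card (set cs)"
  unfolding opt_def using assms by (intro Least_le) blast

section \<open>Hubs, connectors and spare cells\<close>

definition hub :: "nat \<Rightarrow> int \<times> int" where
  "hub i = (2 * int i, 0)"

definition link :: "nat \<Rightarrow> int \<times> int" where
  "link i = (2 * int i + 1, 0)"

text \<open>Consecutive detours lie on opposite sides of the row of hubs, so that they do not touch.\<close>

definition detour1 :: "nat \<Rightarrow> int \<times> int" where
  "detour1 i = (if even i then (2 * int i, 1) else (2 * int i + 1, - 1))"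

definition detour2 :: "nat \<Rightarrow> int \<times> int" where
  "detour2 i = (if even i then (2 * int i + 1, 1) else (2 * int i + 2, - 1))"

text \<open>Row 5 is out of reach of the rows -1, 0 and 1 that hold all other cells, and using even
  columns only keeps spare cells apart.\<close>

definition spare :: "nat \<Rightarrow> int \<times> int" where
  "spare j = (2 * int j, 5)"

lemmas cell_defs = hub_def link_def detour1_def detour2_def spare_def

definition connectors :: "nat \<Rightarrow> nat set \<Rightarrow> (int \<times> int) set" where
  "connectors m S =
     link ` ({..<m} \<inter> S) \<union> detour1 ` ({..<m} - S) \<union> detour2 ` ({..<m} - S)"

lemma finite_connectors: "finite (connectors m S)"
  by (simp add: connectors_def)

lemma card_connectors: "card (connectors m S) \<le> 2 * m"
proof -
  have "card (connectors m S) \<le> card ({..<m} \<inter> S) + card ({..<m} - S) + card ({..<m} - S)"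
    unfolding connectors_def
    by (intro order_trans[OF card_Un_le] add_mono card_image_le) auto
  also have "\<dots> \<le> 2 * (card ({..<m} \<inter> S) + card ({..<m} - S))" by simp
  also have "card ({..<m} \<inter> S) + card ({..<m} - S) = m"
    using card_Int_Diff[of "{..<m}" S] by simp
  finally show ?thesis .
qed

section \<open>The offline two-coloring\<close>

fun phase :: "nat set \<Rightarrow> nat \<Rightarrow> bool" where
  "phase S 0 = True"
| "phase S (Suc i) = (phase S i \<longleftrightarrow> i \<in> S)"

text \<open>The color class \<open>phase S i\<close> of hub \<open>i\<close> flips exactly across
  detours. One coordinate formula extends it to all cells: \<open>a div 2\<close> is the index of a
  nearby hub, and row and column parity decide whether the cell takes or opposes its class.\<close>

definition shade :: "nat set \<Rightarrow> int \<times> int \<Rightarrow> bool" where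
  "shade S = (\<lambda>(a, b). (phase S (nat (a div 2)) = even a) = (b = 0 \<or> b = - 1 \<and> odd a))"

lemma nat_half:
  "nat (2 * int i div 2) = i" "nat ((2 * int i + 1) div 2) = i"
  "nat (int i + 1) = Suc i"
  by simp_all

text \<open>For odd \<open>i\<close>, \<open>detour2 i\<close> lies in column
  \<open>2 * i + 2\<close>, so the formula reads \<open>phase S (Suc i)\<close> there; it is the
  opposite of \<open>phase S i\<close> because \<open>i \<notin> S\<close>.\<close>

lemma shade_simps:
  "shade S (hub i) = phase S i"
  "shade S (link i) = (\<not> phase S i)"
  "shade S (detour1 i) = (\<not> phase S i)"
  "i \<notin> S \<Longrightarrow> shade S (detour2 i) = phase S i"
  by (auto simp: shade_def cell_defs nat_half)

lemma double_neq: "2 * a \<noteq> 1 + 2 * b" "2 * a \<noteq> 2 * b + 1" for a b :: int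
  by presburger+

lemma double_eq: "2 * int i = 2 + 2 * int j \<longleftrightarrow> i = Suc j"
  by auto

lemma neighboring_row:
  "neighboring_cells (hub i) (hub j) \<longleftrightarrow> False"
  "neighboring_cells (hub i) (link j) \<longleftrightarrow> i = j \<or> i = Suc j"
  "neighboring_cells (link i) (link j) \<longleftrightarrow> False"
  by (auto simp: cell_defs neighboring_cells_Pair double_neq double_eq)

lemma neighboring_detour:
  "neighboring_cells (hub i) (detour1 j) \<longleftrightarrow> i = j"
  "neighboring_cells (hub i) (detour2 j) \<longleftrightarrow> i = Suc j"
  "neighboring_cells (link i) (detour1 j) \<longleftrightarrow> i = j"
  "neighboring_cells (link i) (detour2 j) \<longleftrightarrow> i = j"
  by (auto simp: cell_defs neighboring_cells_Pair double_neq double_eq)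

lemma neighboring_detours:
  "neighboring_cells (detour1 i) (detour1 j) \<longleftrightarrow> False"
  "neighboring_cells (detour1 i) (detour2 j) \<longleftrightarrow> i = j"
  "neighboring_cells (detour2 i) (detour2 j) \<longleftrightarrow> False"
  by (auto simp: cell_defs neighboring_cells_Pair double_neq double_eq)

lemma neighboring_spare:
  "neighboring_cells (hub i) (spare j) \<longleftrightarrow> False"
  "neighboring_cells (link i) (spare j) \<longleftrightarrow> False"
  "neighboring_cells (detour1 i) (spare j) \<longleftrightarrow> False"
  "neighboring_cells (detour2 i) (spare j) \<longleftrightarrow> False"
  "neighboring_cells (spare i) (spare j) \<longleftrightarrow> False"
  by (auto simp: cell_defs neighboring_cells_Pair double_neq double_eq)

lemmas neighboring_forward =
  neighboring_row neighboring_detour neighboring_detours neighboring_spare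

lemmas neighboring_simps =
  neighboring_forward neighboring_forward[THEN neighboring_cells_commute[THEN trans]]

text \<open>The adjacent cells \<open>link i\<close> and \<open>detour1 i\<close> have equal shades,
  but \<open>connectors m S\<close> never contains both, since they require \<open>i \<in> S\<close>
  and \<open>i \<notin> S\<close>.\<close>

lemma shade_proper:
  assumes "x \<in> range hub \<union> connectors m S \<union> range spare"
    and "y \<in> range hub \<union> connectors m S \<union> range spare"
    and "neighboring_cells x y"
  shows "shade S x \<noteq> shade S y"
  using assms unfolding connectors_def
  by (auto simp: neighboring_simps shade_simps)

text \<open>Two colors alternate along a path. A link joins consecutive hubs by a path with two
  edges, a detour by one with three, so parity decides whether the hubs agree.\<close>

lemma two_coloring_hubs:
  assumes proper: "\<And>x y. x \<in> D \<Longrightarrow> y \<in> D \<Longrightarrow> neighboring_cells x y \<Longrightarrow> k x \<noteq> k y"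
    and two: "finite D" "card (k ` D) \<le> 2"
    and D: "hub ` {..m} \<union> connectors m S \<subseteq> D"
    and i: "i < m"
  shows "k (hub (Suc i)) = k (hub i) \<longleftrightarrow> i \<in> S"
proof -
  \<comment> \<open>With two colors available, any two values that avoid \<open>k y\<close>
    coincide.\<close>
  have third: "k x = k z" if "x \<in> D" "y \<in> D" "z \<in> D" "k x \<noteq> k y" "k y \<noteq> k z" for x y z
  proof (rule ccontr)
    assume "k x \<noteq> k z"
    then have "card {k x, k y, k z} = 3" using that by auto
    moreover have "card {k x, k y, k z} \<le> card (k ` D)"
      using that two by (intro card_mono) auto
    ultimately show False using two by simp
  qed
  have hubs: "hub i \<in> D" "hub (Suc i) \<in> D" using D i by auto
  show ?thesis
  proof (cases "i \<in> S")
    case True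
    then have "link i \<in> D" using D i by (auto simp: connectors_def)
    then have "k (hub i) = k (hub (Suc i))"
      using hubs by (intro third[of _ "link i"] proper) (auto simp: neighboring_simps)
    with True show ?thesis by simp
  next
    case False
    then have d: "detour1 i \<in> D" "detour2 i \<in> D" using D i by (auto simp: connectors_def)
    then have "k (hub i) = k (detour2 i)"
      using hubs by (intro third[of _ "detour1 i"] proper) (auto simp: neighboring_simps)
    moreover have "k (detour2 i) \<noteq> k (hub (Suc i))"
      using d hubs by (intro proper) (auto simp: neighboring_simps)
    ultimately show ?thesis using False by simp
  qed
qed

section \<open>Request sequences of length \<open>n\<close>\<close>

definition hex_box :: "nat \<Rightarrow> (int \<times> int) set" where
  "hex_box n = {0..2 * int n} \<times> {- 1..5}"

lemma ex_request_sequence: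
  assumes "3 * m + 1 \<le> n"
  obtains ys where "distinct (map hub [0..<Suc m] @ ys)"
    "length (map hub [0..<Suc m] @ ys) = n"
    "connectors m S \<subseteq> set ys" "set ys \<subseteq> connectors m S \<union> range spare"
    "set (map hub [0..<Suc m] @ ys) \<subseteq> hex_box n"
proof -
  \<comment> \<open>The padding needed. The subtraction is not truncated: \<open>Suc m\<close> hubs
    and at most \<open>2 * m\<close> connectors make at most \<open>3 * m + 1 \<le> n\<close>
    requests.\<close>
  define l where "l = n - Suc m - card (connectors m S)"
  define R where "R = connectors m S \<union> spare ` {..<l}"
  have "finite R" by (simp add: R_def finite_connectors)
  then obtain ys where ys: "set ys = R" "distinct ys"
    using finite_distinct_list by blast
  have "inj hub" "inj_on spare {..<l}" by (auto simp: inj_on_def cell_defs)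
  have "connectors m S \<inter> spare ` {..<l} = {}"
    by (auto simp: connectors_def cell_defs split: if_splits)
  then have "card R = card (connectors m S) + l"
    unfolding R_def using \<open>inj_on spare {..<l}\<close>
    by (subst card_Un_disjoint) (auto simp: finite_connectors card_image)
  then have "length ys = n - Suc m"
    using ys card_connectors[of m S] assms by (simp add: distinct_card[symmetric] l_def)
  have hR: "hub i \<notin> R" for i
    unfolding R_def by (auto simp: connectors_def cell_defs double_neq split: if_splits)
  show ?thesis
  proof
    have "distinct (map hub [0..<Suc m])"
      using inj_on_subset[OF \<open>inj hub\<close>] by (simp only: distinct_map distinct_upt simp_thms) blast
    then show "distinct (map hub [0..<Suc m] @ ys)"
      using ys hR by auto
    show "length (map hub [0..<Suc m] @ ys) = n"
      using \<open>length ys = n - Suc m\<close> assms by simp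
    show "connectors m S \<subseteq> set ys" "set ys \<subseteq> connectors m S \<union> range spare"
      using ys by (auto simp: R_def)
    have "hub ` {..m} \<subseteq> hex_box n" "connectors m S \<subseteq> hex_box n" "spare ` {..<l} \<subseteq> hex_box n"
      using assms by (auto simp: hex_box_def connectors_def cell_defs l_def)
    then show "set (map hub [0..<Suc m] @ ys) \<subseteq> hex_box n"
      using ys by (auto simp: R_def)
  qed
qed

section \<open>From the competitive ratio to the advice bound\<close>

lemma strict_competitive_ratio_lessD:
  assumes "strict_competitive_ratio A \<Phi> < ereal r"
  obtains c where "c < r"
    "\<And>G rs. (G, rs) \<in> hex_inputs \<Longrightarrow>
       real (card (set (online_colors A \<Phi> G rs))) \<le> c * real (opt G rs)"
proof -
  \<comment> \<open>The infimum need not be attained, but strictness leaves room for an admissible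
    constant below \<open>r\<close>.\<close>
  from assms obtain c where "c < r" "\<forall>(G, rs) \<in> hex_inputs.
      real (card (set (online_colors A \<Phi> G rs))) \<le> c * real (opt G rs)"
    unfolding strict_competitive_ratio_def Inf_less_iff by auto
  with that show ?thesis by fast
qed

theorem theorem6:
  fixes A :: "'v::infinite online_algorithm" and \<Phi> :: "'v advisor" and n :: nat
  assumes "hex_multicoloring_algorithm A \<Phi>"
    and "strict_competitive_ratio A \<Phi> < 3 / 2"
  shows "advice_complexity A \<Phi> n \<ge> enat (nat \<lfloor>(real n - 1) / 3\<rfloor>)"
proof (rule ccontr)
  define m where "m = nat \<lfloor>(real n - 1) / 3\<rfloor>"
  assume "\<not> ?thesis"
  then have less: "advice_complexity A \<Phi> n < enat m" by (simp add: m_def)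
  \<comment> \<open>Positivity makes \<open>nat\<close> exact on the floor below and
    \<open>m - 1\<close> a true predecessor in the counting.\<close>
  then have "m > 0" by (cases m) (auto simp: zero_enat_def[symmetric])
  have "3 * m + 1 \<le> n"
  proof -
    have "int m = \<lfloor>(real n - 1) / 3\<rfloor>"
      using \<open>m > 0\<close> unfolding m_def by simp
    then have "real m \<le> (real n - 1) / 3" by linarith
    then have "real (3 * m + 1) \<le> real n" by (simp add: field_simps)
    then show ?thesis by (simp only: of_nat_le_iff)
  qed
  have "strict_competitive_ratio A \<Phi> < ereal (3 / 2)"
    using assms(2) by (simp add: numeral_eq_ereal)
  then obtain c where c: "c < 3 / 2" "\<And>G rs. (G, rs) \<in> hex_inputs \<Longrightarrow>
      real (card (set (online_colors A \<Phi> G rs))) \<le> c * real (opt G rs)"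
    by (rule strict_competitive_ratio_lessD) blast
  obtain e :: "nat \<Rightarrow> 'v" where "inj e"
    using infinite_UNIV infinite_countable_subset by blast
  define f :: "int \<times> int \<Rightarrow> 'v" where "f = e \<circ> to_nat"
  have "inj f" unfolding f_def using \<open>inj e\<close> by (intro inj_compose) auto
  \<comment> \<open>The algorithm knows the graph in advance, so the graph must not depend on
    \<open>S\<close>; apart from the tape, \<open>S\<close> shows only in the requests after
    \<open>hubs\<close>.\<close>
  define G where "G = cell_graph f (hex_box n)"
  define hubs where "hubs = map hub [0..<Suc m]"
  have "hexagonal_graph G"
    unfolding G_def using \<open>inj f\<close> by (intro hexagonal_cell_graph) (auto simp: hex_box_def)
  have "\<exists>ys. distinct (hubs @ ys) \<and> length (hubs @ ys) = n \<and> connectors m S \<subseteq> set ys \<and>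
      set ys \<subseteq> connectors m S \<union> range spare \<and> set (hubs @ ys) \<subseteq> hex_box n" for S
    using ex_request_sequence[OF \<open>3 * m + 1 \<le> n\<close>, of S] unfolding hubs_def by metis
  then obtain tail where tail: "distinct (hubs @ tail S)" "length (hubs @ tail S) = n"
      "connectors m S \<subseteq> set (tail S)" "set (tail S) \<subseteq> connectors m S \<union> range spare"
      "set (hubs @ tail S) \<subseteq> hex_box n" for S
    by metis
  define rs where "rs S = map f (hubs @ tail S)" for S
  have input: "(G, rs S) \<in> hex_inputs" for S
    using \<open>hexagonal_graph G\<close> tail(5)[of S]
    by (auto simp: hex_inputs_def rs_def G_def cell_graph_def)
  have opt: "opt G (rs S) \<le> 2" for S
  proof -
    let ?k = "\<lambda>x. if shade S x then 1 else 2 :: nat"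
    have "set (hubs @ tail S) \<subseteq> range hub \<union> connectors m S \<union> range spare"
      using tail(4)[of S] by (auto simp: hubs_def)
    then have "shade S x \<noteq> shade S y"
      if "x \<in> set (hubs @ tail S)" "y \<in> set (hubs @ tail S)" "neighboring_cells x y" for x y
      using shade_proper[OF _ _ that(3)] that(1,2) by (meson subsetD)
    then have "multicoloring G (rs S) (map ?k (hubs @ tail S))"
      unfolding G_def rs_def multicoloring_cell_graph_map[OF \<open>inj f\<close> tail(1,5)] by simp
    then have "opt G (rs S) \<le> card (set (map ?k (hubs @ tail S)))" by (rule opt_le)
    also have "\<dots> \<le> card {1, 2 :: nat}" by (intro card_mono) auto
    finally show ?thesis by simp
  qed
  \<comment> \<open>The key claim: the answers to the hubs alone encode \<open>S\<close>, and they
    depend on at most the first \<open>m - 1\<close> tape positions.\<close>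
  have hub_colors: "\<exists>ds h. run A G (\<Phi> G (rs S)) (map f hubs) ds h \<and>
      (\<forall>p b. (p, b) \<in> set h \<longrightarrow> p < m - 1) \<and>
      (\<forall>i<m. ds ! Suc i = ds ! i \<longleftrightarrow> i \<in> S)" for S
  proof -
    let ?xs = "hubs @ tail S"
    from assms(1) input obtain cs h where
      r: "run A G (\<Phi> G (rs S)) (rs S) cs h" and mc: "multicoloring G (rs S) cs"
      unfolding hex_multicoloring_algorithm_def by blast
    have "enat (max_index_read h) \<le> advice_complexity A \<Phi> n"
      unfolding advice_complexity_def bits_read_eq[of A G \<Phi>, OF r, symmetric]
      using input tail(2)[of S] by (intro SUP_upper2[of "(G, rs S)"]) (auto simp: rs_def)
    with less have "max_index_read h < m"
      by (metis enat_ord_simps(2) order_le_less_trans)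
    \<comment> \<open>Position \<open>p\<close> has index \<open>Suc p\<close>, and this index is
      below \<open>m\<close>.\<close>
    then have bits: "p < m - 1" if "(p, b) \<in> set h" for p b
      using max_index_read_ge[OF that] by linarith
    have "real (card (set cs)) \<le> c * real (opt G (rs S))"
      using c(2)[OF input[of S]] online_colors_eq[of A G \<Phi>, OF r] by simp
    \<comment> \<open>Taking \<open>max 0 c\<close> covers a negative \<open>c\<close>, for which
      the bound on \<open>opt\<close> could not be multiplied through. The product is below 3, so by
      integrality at most two colors occur.\<close>
    also have "\<dots> \<le> max 0 c * 2"
      using opt[of S] by (intro mult_mono) auto
    also have "\<dots> < 3" using c(1) by auto
    finally have two: "card (set cs) \<le> 2" by simp
    have len: "length cs = length ?xs"
      using run_length[OF r] by (simp add: rs_def)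
    \<comment> \<open>As the requests are distinct, the list of answers is a function on
      cells.\<close>
    define k where "k x = the (map_of (zip ?xs cs) x)" for x
    have cs: "cs = map k ?xs"
      using len tail(1)[of S]
      by (intro nth_equalityI) (simp_all add: k_def map_of_zip_nth del: map_append)
    have "k x \<noteq> k y" if "x \<in> set ?xs" "y \<in> set ?xs" "neighboring_cells x y" for x y
      using mc that unfolding G_def rs_def cs multicoloring_cell_graph_map[OF \<open>inj f\<close> tail(1,5)]
      by blast
    moreover have "card (k ` set ?xs) \<le> 2" using two unfolding cs by (simp add: image_Un)
    moreover have "hub ` {..m} \<union> connectors m S \<subseteq> set ?xs"
      using tail(3)[of S]
      by (auto simp: hubs_def atLeast0LessThan lessThan_Suc_atMost simp del: upt_Suc)
    ultimately have k: "k (hub (Suc i)) = k (hub i) \<longleftrightarrow> i \<in> S" if "i < m" for i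
      using that by (intro two_coloring_hubs[of "set ?xs" k m S i]) auto
    \<comment> \<open>Cutting the run after the last hub keeps the hub colors and the bound on the
      positions read.\<close>
    from r have "run A G (\<Phi> G (rs S)) (map f hubs @ map f (tail S)) cs h"
      by (simp add: rs_def)
    then obtain ds es h' where ds: "cs = ds @ es" "run A G (\<Phi> G (rs S)) (map f hubs) ds h'"
      "set h' \<subseteq> set h" by (rule run_prefix)
    have "length ds = Suc m" using run_length[OF ds(2)] by (simp add: hubs_def)
    have nth: "ds ! i = k (hub i)" if "i \<le> m" for i
    proof -
      have "ds ! i = cs ! i" using ds(1) that \<open>length ds = Suc m\<close> by (simp add: nth_append)
      also have "\<dots> = k (hub i)" using that
        unfolding cs by (simp add: nth_append hubs_def del: upt_Suc)
      finally show ?thesis .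
    qed
    show ?thesis
      using ds bits k nth by (intro exI[of _ ds] exI[of _ h']) auto
  qed
  \<comment> \<open>The readable part of the tape, as a set of positions: \<open>2 ^ (m - 1)\<close>
    possible values for \<open>2 ^ m\<close> sets \<open>S\<close>.\<close>
  define advice where "advice S = {p. p < m - 1 \<and> \<Phi> G (rs S) p}" for S
  have "advice ` Pow {..<m} \<subseteq> Pow {..<m - 1}" by (auto simp: advice_def)
  then have "card (advice ` Pow {..<m}) \<le> card (Pow {..<m - 1})"
    by (intro card_mono) auto
  also have "\<dots> < card (Pow {..<m})"
    using \<open>m > 0\<close> by (simp add: card_Pow)
  finally have "\<not> inj_on advice (Pow {..<m})" by (rule pigeonhole)
  then obtain S T where ST: "S \<subseteq> {..<m}" "T \<subseteq> {..<m}" "advice S = advice T" "S \<noteq> T"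
    by (auto simp: inj_on_def)
  from hub_colors[of S] obtain ds h where S: "run A G (\<Phi> G (rs S)) (map f hubs) ds h"
    "\<And>p b. (p, b) \<in> set h \<Longrightarrow> p < m - 1" "\<And>i. i < m \<Longrightarrow> ds ! Suc i = ds ! i \<longleftrightarrow> i \<in> S"
    by blast
  from hub_colors[of T] obtain ds' h' where T: "run A G (\<Phi> G (rs T)) (map f hubs) ds' h'"
    "\<And>i. i < m \<Longrightarrow> ds' ! Suc i = ds' ! i \<longleftrightarrow> i \<in> T"
    by blast
  have "\<Phi> G (rs S) p = \<Phi> G (rs T) p" if "p < m - 1" for p
    using ST(3) that by (auto simp: advice_def set_eq_iff)
  \<comment> \<open>The tapes agree wherever the run for \<open>S\<close> looks, so it is also a run
    on the tape for \<open>T\<close>; determinism then gives both the same hub colors.\<close>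
  then have "run A G (\<Phi> G (rs T)) (map f hubs) ds h"
    using S(1,2) by (intro run_cong_tape[OF S(1)]) blast
  then have "ds = ds'" using T(1) run_deterministic by blast
  then have "i \<in> S \<longleftrightarrow> i \<in> T" if "i < m" for i
    using S(3) T(2) that by blast
  with ST show False by blast
qed

end
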